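(* Let $\mathcal H$ be a real Hilbert space, $h>0$, $\gamma>0$, $\beta\ge0$. Let $f\in C^1(\mathcal H)$ be real-valued with $\inf_{\mathcal H}f>-\infty$ and $\nabla f$ globally $L$-Lipschitz continuous, $L\ge0$. Let $\phi:\mathcal H\to\mathbb R\cup\{+\infty\}$ be proper, lower semicontinuous and convex with $\phi(0)=\min\phi=0$, and let $r>0$ satisfy $r\mathbb B\subseteq\partial\phi(0)$. Let $x_0\in\mathcal H$, $v_0\in\mathrm{dom}(\phi)$ and let $(x_k,v_k)_{k\ge0}$ be generated by $$\frac{v_{k+1}-v_k}{h}+\gamma v_{k+1}+\partial\phi(v_{k+1})+\nabla f(x_k+\beta v_k)\ni0,\qquad \frac{x_{k+1}-x_k}{h}=v_{k+1}\qquad(k\ge0).$$ Set $y_k=x_k+\beta v_k$, $d_{k+1}=v_{k+1}-v_k$, $\mathcal E_0^h=f(y_0)-\inf_{\mathcal H}f+\frac{1+\beta\gamma}{2}\|v_0\|^2+\beta\phi(v_0)$. Assume that the matrix $$M_h=\begin{pmatrix}h\gamma-\frac{Lh^2}{2}&-\frac{Lh\beta}{2}\\-\frac{Lh\beta}{2}&\frac12+\frac{\beta}{h}+\frac{\beta\gamma}{2}-\frac{L\beta^2}{2}\end{pmatrix}$$ is positive semidefinite. Then $$hr\sum_{k=0}^{+\infty}\|v_{k+1}\|\le h\sum_{k=0}^{+\infty}\phi(v_{k+1})\le\mathcal E_0^h .$$ Consequently there exists $x_\infty\in\mathcal H$ such that, strongly, $x_k\to x_\infty$, $v_k\to0$,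 $d_{k+1}\to0$, $y_k\to x_\infty$, and $$-\nabla f(x_\infty)\in\partial\phi(0).$$ Moreover, if $M_h$ is positive definite, then $\sum_{k=0}^{+\infty}\left(\|v_{k+1}\|^2+\|d_{k+1}\|^2\right)<+\infty$.
   Context: $\mathbb B$ is the closed unit ball, $\partial\phi$ the convex subdifferential, $\mathrm{dom}(\phi)=\{v:\phi(v)<+\infty\}$. The recursion has a unique solution: $v_{k+1}=\mathrm{prox}_{\lambda_h\phi}\bigl(\frac{1}{1+h\gamma}v_k-\lambda_h\nabla f(x_k+\beta v_k)\bigr)$ with $\lambda_h=\frac{h}{1+h\gamma}$. When $\beta=0$ the term $\beta\phi(v_0)$ is omitted. *)

theory Defs
  imports "HOL-Analysis.Analysis"
begin

definition proper_fun :: "('a \<Rightarrow> ereal) \<Rightarrow> bool" where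
  "proper_fun \<phi> \<longleftrightarrow> (\<forall>x. \<phi> x \<noteq> -\<infinity>) \<and> (\<exists>x. \<phi> x \<noteq> \<infinity>)"

definition eff_dom :: "('a \<Rightarrow> ereal) \<Rightarrow> 'a set" where
  "eff_dom \<phi> = {v. \<phi> v < \<infinity>}"

definition lsc_fun :: "('a::topological_space \<Rightarrow> ereal) \<Rightarrow> bool" where
  "lsc_fun \<phi> \<longleftrightarrow> (\<forall>x. \<phi> x \<le> Liminf (nhds x) \<phi>)"

text \<open>Intended for functions that do not take the value $-\infty$. In \<^typ>\<open>ereal\<close> we have
  $0 \cdot \infty = 0$, so the endpoints of the interval of weights are harmless.\<close>

definition convex_fun :: "('a::real_vector \<Rightarrow> ereal) \<Rightarrow> bool" where
  "convex_fun \<phi> \<longleftrightarrow>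
     (\<forall>x y. \<forall>t\<in>{0..1::real}.
        \<phi> ((1 - t) *\<^sub>R x + t *\<^sub>R y) \<le> ereal (1 - t) * \<phi> x + ereal t * \<phi> y)"

text \<open>For proper \<open>\<phi>\<close> this set is empty at every point outside \<open>eff_dom \<phi>\<close>, as usual.\<close>

definition subdifferential :: "('a::real_inner \<Rightarrow> ereal) \<Rightarrow> 'a \<Rightarrow> 'a set" where
  "subdifferential \<phi> x = {p. \<forall>y. \<phi> x + ereal (p \<bullet> (y - x)) \<le> \<phi> y}"

definition pos_semidef :: "real ^ 'n ^ 'n \<Rightarrow> bool" where
  "pos_semidef A \<longleftrightarrow> transpose A = A \<and> (\<forall>z. 0 \<le> z \<bullet> (A *v z))"

definition pos_def :: "real ^ 'n ^ 'n \<Rightarrow> bool" where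
  "pos_def A \<longleftrightarrow> transpose A = A \<and> (\<forall>z. z \<noteq> 0 \<longrightarrow> 0 < z \<bullet> (A *v z))"

definition M_mat :: "real \<Rightarrow> real \<Rightarrow> real \<Rightarrow> real \<Rightarrow> real ^ 2 ^ 2" where
  "M_mat h \<gamma> \<beta> L =
     vector [vector [h * \<gamma> - L * h\<^sup>2 / 2, - (L * h * \<beta> / 2)],
             vector [- (L * h * \<beta> / 2), 1 / 2 + \<beta> / h + \<beta> * \<gamma> / 2 - L * \<beta>\<^sup>2 / 2]]"

end

theory Submission
  imports Defs
begin

text \<open>
  Along the recursion the energy
  \<open>E k = f (y k) - inf f + (1 + \<beta> \<gamma>) / 2 * \<parallel>v k\<parallel>\<^sup>2 + \<beta> * \<phi> (v k)\<close> decreases by at least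
  \<open>h * \<phi> (v (k + 1)) + Q\<close>, where \<open>Q\<close> is the quadratic form of the matrix evaluated at the pair
  \<open>(v (k + 1), d (k + 1))\<close>. This comes from the descent lemma applied to the step
  \<open>y (k + 1) - y k = h v (k + 1) + \<beta> d (k + 1)\<close>, with the subgradient inequality tested at \<open>0\<close>
  for the part in \<open>v (k + 1)\<close> and at \<open>v k\<close> for the part in \<open>d (k + 1)\<close>. Telescoping bounds the
  sum of the \<open>\<phi> (v (k + 1))\<close>; since \<open>r * \<parallel>v\<parallel> \<le> \<phi> v\<close>, the trajectory has finite length.
\<close>

text \<open>Along the segment, \<open>f\<close> minus its linear part minus
  \<open>L * t\<^sup>2 / 2 * (norm u)\<^sup>2\<close> has nonpositive derivative: Cauchy-Schwarz and
  the Lipschitz bound control the change of the gradient by \<open>L * t * norm u\<close>.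
  Monotonicity then replaces an integral of the gradient.\<close>

lemma lipschitz_gradient_descent:
  fixes f :: "'a::real_inner \<Rightarrow> real"
  assumes grad: "\<And>z. GDERIV f z :> gradf z" and lip: "L-lipschitz_on UNIV gradf"
  shows "f (z + u) \<le> f z + gradf z \<bullet> u + L / 2 * (norm u)\<^sup>2"
proof -
  define g where "g t = f (z + t *\<^sub>R u) - t * (gradf z \<bullet> u) - L * t\<^sup>2 / 2 * (norm u)\<^sup>2" for t
  have "g 1 \<le> g 0"
  proof (rule DERIV_nonpos_imp_nonincreasing[of 0 1 g])
    fix t :: real
    assume t: "0 \<le> t" "t \<le> 1"
    have "(f has_derivative (\<lambda>w. w \<bullet> gradf (z + t *\<^sub>R u))) (at (z + t *\<^sub>R u))"
      using grad by (simp add: gderiv_def)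
    then have "((\<lambda>t. f (z + t *\<^sub>R u)) has_derivative (\<lambda>s. (s *\<^sub>R u) \<bullet> gradf (z + t *\<^sub>R u))) (at t)"
      by (rule has_derivative_compose[rotated]) (auto intro!: derivative_eq_intros)
    then have *: "((\<lambda>t. f (z + t *\<^sub>R u)) has_real_derivative (u \<bullet> gradf (z + t *\<^sub>R u))) (at t)"
      by (rule has_derivative_imp_has_field_derivative) (simp add: mult.commute)
    have "(g has_real_derivative
        (u \<bullet> gradf (z + t *\<^sub>R u) - gradf z \<bullet> u - L * t * (norm u)\<^sup>2)) (at t)"
      unfolding g_def by (auto intro!: derivative_eq_intros * simp: algebra_simps)
    moreover have "u \<bullet> gradf (z + t *\<^sub>R u) - gradf z \<bullet> u - L * t * (norm u)\<^sup>2 \<le> 0"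
    proof -
      have "(gradf (z + t *\<^sub>R u) - gradf z) \<bullet> u \<le> norm (gradf (z + t *\<^sub>R u) - gradf z) * norm u"
        by (rule norm_cauchy_schwarz)
      also have "\<dots> \<le> (L * (t * norm u)) * norm u"
        using lipschitz_onD[OF lip, of "z + t *\<^sub>R u" z] t
        by (intro mult_right_mono) (auto simp: dist_norm)
      finally show ?thesis
        by (simp add: inner_diff_left inner_commute power2_eq_square algebra_simps)
    qed
    ultimately show "\<exists>D. (g has_real_derivative D) (at t) \<and> D \<le> 0"
      by blast
  qed simp
  then show ?thesis
    by (simp add: g_def)
qed

text \<open>Among the subgradients in the ball, \<open>r *\<^sub>R sgn w\<close> points along
  \<open>w\<close> and gives the strongest bound. This linear growth turns summability of the values
  of \<phi> into finite length.\<close>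

lemma norm_le_of_cball_subset_subdifferential:
  assumes "\<phi> 0 = 0" and "r \<ge> 0" and sub: "cball 0 r \<subseteq> subdifferential \<phi> 0"
  shows "ereal (r * norm w) \<le> \<phi> w"
proof -
  have "r *\<^sub>R sgn w \<in> cball 0 r"
    using \<open>r \<ge> 0\<close> by (simp add: norm_sgn)
  then have "\<phi> 0 + ereal ((r *\<^sub>R sgn w) \<bullet> (w - 0)) \<le> \<phi> w"
    using sub unfolding subdifferential_def by blast
  moreover have "sgn w \<bullet> w = norm w"
    by (cases "w = 0") (auto simp: sgn_div_norm dot_square_norm power2_eq_square)
  ultimately show ?thesis
    using \<open>\<phi> 0 = 0\<close> by simp
qed

text \<open>The constant is the minimum of the form on the compact unit sphere; homogeneity of
  degree two carries the bound to all vectors.\<close>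

lemma pos_def_coercive:
  assumes "pos_def A"
  obtains c where "c > 0" and "\<And>z. c * (norm z)\<^sup>2 \<le> z \<bullet> (A *v z)"
proof -
  have "\<exists>w\<in>sphere 0 1. \<forall>z\<in>sphere 0 1. w \<bullet> (A *v w) \<le> z \<bullet> (A *v z)"
    by (rule continuous_attains_inf)
      (auto intro!: continuous_intros matrix_vector_mult_linear_continuous_on)
  then obtain w where w: "norm w = 1" "\<And>z. norm z = 1 \<Longrightarrow> w \<bullet> (A *v w) \<le> z \<bullet> (A *v z)"
    by auto
  show ?thesis
  proof
    show "w \<bullet> (A *v w) > 0"
    proof -
      have "w \<noteq> 0"
        using w(1) by auto
      then show ?thesis
        using assms by (simp add: pos_def_def)
    qed
    show "w \<bullet> (A *v w) * (norm z)\<^sup>2 \<le> z \<bullet> (A *v z)" for z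
    proof (cases "z = 0")
      case False
      then have "w \<bullet> (A *v w) \<le> sgn z \<bullet> (A *v sgn z)"
        by (intro w(2)) (simp add: norm_sgn)
      also have "\<dots> = z \<bullet> (A *v z) / (norm z)\<^sup>2"
        by (simp add: sgn_div_norm matrix_vector_mult_scaleR power2_eq_square divide_inverse)
      finally show ?thesis
        using False by (simp add: field_simps)
    qed simp
  qed
qed

lemma inner_matrix_vector_2:
  fixes A :: "real ^ 2 ^ 2"
  assumes "transpose A = A"
  shows "z \<bullet> (A *v z) = A $ 1 $ 1 * (z $ 1)\<^sup>2 + 2 * A $ 1 $ 2 * (z $ 1 * z $ 2) + A $ 2 $ 2 * (z $ 2)\<^sup>2"
proof -
  have "A $ 2 $ 1 = A $ 1 $ 2"
    using arg_cong[OF assms, of "\<lambda>B. B $ 1 $ 2"] by (simp add: transpose_def)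
  then show ?thesis
    by (simp add: inner_vec_def matrix_vector_mult_def sum_2 power2_eq_square algebra_simps)
qed

text \<open>Only the mixed term sees directions, and Cauchy-Schwarz bounds it below by its worst
  case, which a pair of real numbers with suitable signs attains. Hence a bound on the 2 by 2 matrix
  passes to pairs of vectors; \<open>c = 0\<close> serves the semidefinite case,
  \<open>c > 0\<close> the definite one.\<close>

lemma quadratic_form_inner_space_ge:
  fixes A :: "real ^ 2 ^ 2" and v w :: "'a::real_inner"
  assumes sym: "transpose A = A" and ge: "\<And>z. c * (norm z)\<^sup>2 \<le> z \<bullet> (A *v z)"
  shows "c * ((norm v)\<^sup>2 + (norm w)\<^sup>2)
    \<le> A $ 1 $ 1 * (norm v)\<^sup>2 + 2 * A $ 1 $ 2 * (v \<bullet> w) + A $ 2 $ 2 * (norm w)\<^sup>2"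
proof -
  \<comment> \<open>The sign makes the mixed term of the scalar form as negative as
    possible.\<close>
  define s :: real where "s = (if A $ 1 $ 2 \<ge> 0 then -1 else 1)"
  define z :: "real ^ 2" where "z = vector [norm v, s * norm w]"
  have s: "s\<^sup>2 = 1" "A $ 1 $ 2 * s = - \<bar>A $ 1 $ 2\<bar>"
    by (auto simp: s_def)
  have "(norm z)\<^sup>2 = (norm v)\<^sup>2 + (norm w)\<^sup>2"
  proof -
    have "(norm z)\<^sup>2 = (z $ 1)\<^sup>2 + (z $ 2)\<^sup>2"
      unfolding power2_norm_eq_inner by (simp add: inner_vec_def sum_2 power2_eq_square)
    then show ?thesis
      using s(1) by (simp add: z_def power_mult_distrib)
  qed
  moreover have "z \<bullet> (A *v z) = A $ 1 $ 1 * (norm v)\<^sup>2 + 2 * (A $ 1 $ 2 * s) * (norm v * norm w)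
      + A $ 2 $ 2 * (norm w)\<^sup>2"
    unfolding inner_matrix_vector_2[OF sym] z_def using s(1) by (simp add: power_mult_distrib)
  moreover have "- (\<bar>A $ 1 $ 2\<bar> * (norm v * norm w)) \<le> A $ 1 $ 2 * (v \<bullet> w)"
  proof -
    have "\<bar>A $ 1 $ 2 * (v \<bullet> w)\<bar> \<le> \<bar>A $ 1 $ 2\<bar> * (norm v * norm w)"
      unfolding abs_mult by (intro mult_left_mono Cauchy_Schwarz_ineq2) simp
    then show ?thesis by linarith
  qed
  ultimately show ?thesis
    using ge[of z] s(2) by simp
qed

lemma M_mat_entries:
  "M_mat h \<gamma> \<beta> L $ 1 $ 1 = h * \<gamma> - L * h\<^sup>2 / 2"
  "M_mat h \<gamma> \<beta> L $ 1 $ 2 = - (L * h * \<beta> / 2)"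
  "M_mat h \<gamma> \<beta> L $ 2 $ 2 = 1 / 2 + \<beta> / h + \<beta> * \<gamma> / 2 - L * \<beta>\<^sup>2 / 2"
  by (simp_all add: M_mat_def)

text \<open>One step of the recursion, with \<open>g = \<nabla>f (y k)\<close>, \<open>p\<close> the subgradient selected at \<open>v (k + 1)\<close>
  and \<open>a\<close>, \<open>b\<close> the values of \<open>\<phi>\<close> at \<open>v k\<close> and \<open>v (k + 1)\<close>.\<close>

lemma energy_step:
  fixes g p v w :: "'a::real_inner"
  assumes "h > 0" and "\<beta> \<ge> 0"
    and step: "(w - v) /\<^sub>R h + \<gamma> *\<^sub>R w + p + g = 0"
    and desc: "f1 \<le> f0 + g \<bullet> (h *\<^sub>R w + \<beta> *\<^sub>R (w - v)) + L / 2 * (norm (h *\<^sub>R w + \<beta> *\<^sub>R (w - v)))\<^sup>2"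
    and p0: "b \<le> p \<bullet> w" and pv: "b - a \<le> p \<bullet> (w - v)"
  shows "f1 + (1 + \<beta> * \<gamma>) / 2 * (norm w)\<^sup>2 + \<beta> * b + h * b
      + (M_mat h \<gamma> \<beta> L $ 1 $ 1 * (norm w)\<^sup>2 + 2 * M_mat h \<gamma> \<beta> L $ 1 $ 2 * (w \<bullet> (w - v))
        + M_mat h \<gamma> \<beta> L $ 2 $ 2 * (norm (w - v))\<^sup>2)
    \<le> f0 + (1 + \<beta> * \<gamma>) / 2 * (norm v)\<^sup>2 + \<beta> * a"
proof -
  define e where "e = w - v"
  define W D P where "W = (norm w)\<^sup>2" and "D = (norm e)\<^sup>2" and "P = w \<bullet> e"
  have g: "g = - (e /\<^sub>R h) - \<gamma> *\<^sub>R w - p"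
    using step unfolding e_def[symmetric] by (simp add: algebra_simps eq_neg_iff_add_eq_0)
  have "g \<bullet> w = - P / h - \<gamma> * W - p \<bullet> w" and "g \<bullet> e = - D / h - \<gamma> * P - p \<bullet> e"
    unfolding g W_def D_def P_def
    by (simp_all add: inner_diff_left power2_norm_eq_inner inner_commute[of w e] divide_inverse)
  then have "g \<bullet> (h *\<^sub>R w + \<beta> *\<^sub>R e)
      = h * (- P / h - \<gamma> * W - p \<bullet> w) + \<beta> * (- D / h - \<gamma> * P - p \<bullet> e)"
    by (simp add: inner_add_right)
  also have "\<dots> = - P - h * \<gamma> * W - h * (p \<bullet> w) - \<beta> / h * D - \<beta> * \<gamma> * P - \<beta> * (p \<bullet> e)"
    using \<open>h > 0\<close> by (simp add: field_simps)
  finally have lin: "g \<bullet> (h *\<^sub>R w + \<beta> *\<^sub>R e)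
      = - P - h * \<gamma> * W - h * (p \<bullet> w) - \<beta> / h * D - \<beta> * \<gamma> * P - \<beta> * (p \<bullet> e)" .
  have quad: "(norm (h *\<^sub>R w + \<beta> *\<^sub>R e))\<^sup>2 = h\<^sup>2 * W + 2 * h * \<beta> * P + \<beta>\<^sup>2 * D"
    unfolding W_def D_def P_def power2_norm_eq_inner
    by (simp add: inner_add_left inner_add_right inner_commute power2_eq_square algebra_simps)
  \<comment> \<open>With weight \<open>(1 + \<beta> * \<gamma>) / 2\<close> this expansion cancels
    the terms \<open>- P - \<beta> * \<gamma> * P\<close> of \<open>lin\<close>, so the only mixed
    term left is the one from \<open>quad\<close>; it also supplies
    \<open>1 / 2 + \<beta> * \<gamma> / 2\<close> in the lower right entry of the matrix.\<close>
  have V: "(norm v)\<^sup>2 = W - 2 * P + D"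
    unfolding W_def D_def P_def power2_norm_eq_inner e_def
    by (simp add: inner_diff_left inner_diff_right inner_commute algebra_simps)
  have "h * b \<le> h * (p \<bullet> w)" "\<beta> * (b - a) \<le> \<beta> * (p \<bullet> e)"
    using assms by (auto simp: e_def intro!: mult_left_mono)
  with desc show ?thesis
    unfolding e_def[symmetric] M_mat_entries lin quad V W_def[symmetric] P_def[symmetric] D_def[symmetric]
    by (simp add: algebra_simps add_divide_distrib diff_divide_distrib)
qed

text \<open>Telescoping bounds each partial sum by \<open>E 0 - E n\<close>, hence by
  \<open>E 0\<close>. The loss \<open>s\<close> is left free because two different parts of the
  energy decrease are summed later.\<close>

lemma summable_telescoping_bound:
  fixes E s :: "nat \<Rightarrow> real"
  assumes step: "\<And>k. E (Suc k) + s k \<le> E k" and "\<And>k. 0 \<le> E k" and "\<And>k. 0 \<le> s k"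
  shows "summable s" and "suminf s \<le> E 0"
proof -
  have "E n + sum s {..<n} \<le> E 0" for n
  proof (induction n)
    case (Suc n)
    then show ?case using step[of n] by simp
  qed simp
  then have le: "sum s {..<n} \<le> E 0" for n
    using assms(2)[of n] by (metis add_increasing order_trans order_refl)
  show "summable s"
    by (rule summableI_nonneg_bounded[OF assms(3) le])
  then show "suminf s \<le> E 0"
    by (rule suminf_le_const) (rule le)
qed

text \<open>Same as \<open>summable_norm_cancel\<close>, whose sort \<open>banach\<close> is not implied by the sort of the
  Hilbert space, although both describe complete normed spaces.\<close>

lemma summable_norm_cancel_complete:
  fixes u :: "nat \<Rightarrow> 'a::{real_normed_vector, complete_space}"
  assumes "summable (\<lambda>k. norm (u k))"
  shows "summable u"
proof -
  have "Cauchy (\<lambda>n. \<Sum>k<n. norm (u k))"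
    using assms by (simp add: summable_iff_convergent convergent_Cauchy)
  \<comment> \<open>The Cauchy property passes from the partial sums of norms to those of
    \<open>u\<close> by the triangle inequality on the block from \<open>m\<close> to
    \<open>n - 1\<close>.\<close>
  moreover have "dist (\<Sum>k<m. u k) (\<Sum>k<n. u k) \<le> dist (\<Sum>k<m. norm (u k)) (\<Sum>k<n. norm (u k))"
    if "m < n" for m n
  proof -
    have *: "(\<Sum>k<n. g k) - (\<Sum>k<m. g k) = (\<Sum>k=m..<n. g k)"
      for g :: "nat \<Rightarrow> 'c::real_normed_vector"
      using sum_diff_nat_ivl[of 0 m n g] that by (simp add: lessThan_atLeast0)
    show ?thesis
      unfolding dist_commute[of "\<Sum>k<m. u k"] dist_commute[of "\<Sum>k<m. norm (u k)"]
      by (simp add: dist_norm * norm_sum sum_nonneg)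
  qed
  ultimately have "Cauchy (\<lambda>n. \<Sum>k<n. u k)"
    unfolding Cauchy_altdef by (meson le_less_trans)
  then show ?thesis
    by (simp add: summable_iff_convergent Cauchy_convergent_iff)
qed

theorem theorem4p6:
  fixes f :: "'a::{real_inner, complete_space} \<Rightarrow> real"
    and gradf :: "'a \<Rightarrow> 'a"
    and \<phi> :: "'a \<Rightarrow> ereal"
    and x v y d :: "nat \<Rightarrow> 'a"
    and h \<gamma> \<beta> L r :: real
    and E0 :: ereal
  assumes "h > 0" and "\<gamma> > 0" and "\<beta> \<ge> 0"
    and "\<And>z. GDERIV f z :> gradf z"
    and "continuous_on UNIV gradf"
    and "bdd_below (range f)"
    and "L \<ge> 0" and "L-lipschitz_on UNIV gradf"
    and "proper_fun \<phi>" and "lsc_fun \<phi>" and "convex_fun \<phi>"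
    and "\<phi> 0 = 0" and "\<And>z. \<phi> 0 \<le> \<phi> z"
    and "r > 0" and "cball 0 r \<subseteq> subdifferential \<phi> 0"
    and "v 0 \<in> eff_dom \<phi>"
    and "\<And>k. 0 \<in> {(v (Suc k) - v k) /\<^sub>R h + \<gamma> *\<^sub>R v (Suc k) + p + gradf (x k + \<beta> *\<^sub>R v k) | p.
                     p \<in> subdifferential \<phi> (v (Suc k))}"
    and "\<And>k. (x (Suc k) - x k) /\<^sub>R h = v (Suc k)"
    and "\<And>k. y k = x k + \<beta> *\<^sub>R v k"
    and "\<And>k. d (Suc k) = v (Suc k) - v k"
    and "E0 = ereal (f (y 0) - (INF z. f z) + (1 + \<beta> * \<gamma>) / 2 * (norm (v 0))\<^sup>2) + ereal \<beta> * \<phi> (v 0)"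
    and "pos_semidef (M_mat h \<gamma> \<beta> L)"
  shows "ereal (h * r) * (\<Sum>k. ereal (norm (v (Suc k)))) \<le> ereal h * (\<Sum>k. \<phi> (v (Suc k)))
       \<and> ereal h * (\<Sum>k. \<phi> (v (Suc k))) \<le> E0
       \<and> (\<exists>x_inf. x \<longlonglongrightarrow> x_inf \<and> v \<longlonglongrightarrow> 0 \<and> (\<lambda>k. d (Suc k)) \<longlonglongrightarrow> 0 \<and> y \<longlonglongrightarrow> x_inf
            \<and> - gradf x_inf \<in> subdifferential \<phi> 0)
       \<and> (pos_def (M_mat h \<gamma> \<beta> L) \<longrightarrow>
            summable (\<lambda>k. (norm (v (Suc k)))\<^sup>2 + (norm (d (Suc k)))\<^sup>2))"
proof -
  have h: "h > 0" and \<beta>: "\<beta> \<ge> 0" and r: "r > 0" by fact+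
  have \<phi>_ge_0: "0 \<le> \<phi> z" for z
    using assms(12,13) by metis
  have "\<exists>p. p \<in> subdifferential \<phi> (v (Suc k)) \<and>
      (v (Suc k) - v k) /\<^sub>R h + \<gamma> *\<^sub>R v (Suc k) + p + gradf (y k) = 0" for k
    using assms(17)[of k] by (auto simp: assms(19))
  then obtain p where p: "\<And>k. p k \<in> subdifferential \<phi> (v (Suc k))"
    and step: "\<And>k. (v (Suc k) - v k) /\<^sub>R h + \<gamma> *\<^sub>R v (Suc k) + p k + gradf (y k) = 0"
    by metis
  have p_le: "\<phi> (v (Suc k)) + ereal (p k \<bullet> (z - v (Suc k))) \<le> \<phi> z" for k z
    using p by (auto simp: subdifferential_def)
  define a where "a k = real_of_ereal (\<phi> (v k))" for k
  \<comment> \<open>At index 0 this is the assumption on the initial velocity; later a subgradient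
    exists at the point, and its inequality tested at 0, where \<phi> vanishes, excludes an infinite
    value. Hence \<open>a\<close> loses no information.\<close>
  have "\<phi> (v k) < \<infinity>" for k
  proof (cases k)
    case 0
    then show ?thesis using assms(16) by (simp add: eff_dom_def)
  next
    case (Suc n)
    then show ?thesis using p_le[of n 0] assms(12) by (cases "\<phi> (v k)") auto
  qed
  then have a: "\<phi> (v k) = ereal (a k)" for k
    using \<phi>_ge_0[of "v k"] unfolding a_def by (cases "\<phi> (v k)") auto
  have a_ge: "r * norm (v k) \<le> a k" for k
    using norm_le_of_cball_subset_subdifferential[of \<phi> r "v k"] assms(12,15) r a[of k] by simp
  have a_nonneg: "0 \<le> a k" for k
    using \<phi>_ge_0[of "v k"] a[of k] by simp
  have x_step: "x (Suc k) = x k + h *\<^sub>R v (Suc k)" for k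
    using assms(18)[of k] h by (metis add.commute diff_add_cancel divideR_right less_irrefl)

  define E where "E k = f (y k) - (INF z. f z) + (1 + \<beta> * \<gamma>) / 2 * (norm (v k))\<^sup>2 + \<beta> * a k" for k
  define q where "q k = M_mat h \<gamma> \<beta> L $ 1 $ 1 * (norm (v (Suc k)))\<^sup>2
      + 2 * M_mat h \<gamma> \<beta> L $ 1 $ 2 * (v (Suc k) \<bullet> d (Suc k))
      + M_mat h \<gamma> \<beta> L $ 2 $ 2 * (norm (d (Suc k)))\<^sup>2" for k
  \<comment> \<open>Both loss terms are kept: dropping \<open>q k\<close> gives the bound on the sum
    of \<phi>, dropping \<open>h * a (Suc k)\<close> the square summability.\<close>
  have decrease: "E (Suc k) + (h * a (Suc k) + q k) \<le> E k" for k
  proof -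
    let ?u = "h *\<^sub>R v (Suc k) + \<beta> *\<^sub>R (v (Suc k) - v k)"
    have "y (Suc k) = y k + ?u"
      by (simp add: assms(19) x_step algebra_simps)
    then have "f (y (Suc k)) \<le> f (y k) + gradf (y k) \<bullet> ?u + L / 2 * (norm ?u)\<^sup>2"
      using lipschitz_gradient_descent[OF assms(4,8), of "y k" ?u] by simp
    moreover have "a (Suc k) \<le> p k \<bullet> v (Suc k)"
      using p_le[of k 0] assms(12) by (simp add: a)
    moreover have "a (Suc k) - a k \<le> p k \<bullet> (v (Suc k) - v k)"
      using p_le[of k "v k"] by (simp add: a inner_diff_right)
    ultimately show ?thesis
      using energy_step[OF h \<beta> step[of k]] unfolding E_def q_def assms(20)
      by (smt (verit, best))
  qed
  have E_nonneg: "0 \<le> E k" for k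
    using cINF_lower[OF assms(6), of "y k"] assms(2) \<beta> a_nonneg[of k] by (simp add: E_def)
  have q_nonneg: "0 \<le> q k" for k
    using quadratic_form_inner_space_ge[of "M_mat h \<gamma> \<beta> L" 0 "v (Suc k)" "d (Suc k)"] assms(22)
    by (simp add: pos_semidef_def q_def)
  have E0: "E0 = ereal (E 0)"
    using assms(21) a[of 0] by (simp add: E_def)

  have ha_nonneg: "0 \<le> h * a (Suc k)" for k
    using h a_nonneg by simp
  have "E (Suc k) + h * a (Suc k) \<le> E k" for k
    using decrease[of k] q_nonneg[of k] by linarith
  note sum_a = summable_telescoping_bound[of E "\<lambda>k. h * a (Suc k)", OF this E_nonneg ha_nonneg]
  have sa: "summable (\<lambda>k. a (Suc k))"
    using sum_a(1) h by (simp add: summable_cmult_iff)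
  have sv: "summable (\<lambda>k. norm (v (Suc k)))"
  proof (rule summable_comparison_test')
    show "summable (\<lambda>k. a (Suc k) / r)"
      using sa by (rule summable_divide)
    show "norm (norm (v (Suc k))) \<le> a (Suc k) / r" if "k \<ge> 0" for k
      using a_ge[of "Suc k"] r by (simp add: field_simps)
  qed
  have sum_\<phi>: "(\<Sum>k. \<phi> (v (Suc k))) = ereal (\<Sum>k. a (Suc k))"
    unfolding a using sa by (rule suminf_ereal')
  have sum_v: "(\<Sum>k. ereal (norm (v (Suc k)))) = ereal (\<Sum>k. norm (v (Suc k)))"
    using sv by (rule suminf_ereal')

  have "r * (\<Sum>k. norm (v (Suc k))) \<le> (\<Sum>k. a (Suc k))"
    unfolding suminf_mult[OF sv, symmetric]
    by (intro suminf_le a_ge sa summable_mult sv)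
  then have part1: "ereal (h * r) * (\<Sum>k. ereal (norm (v (Suc k)))) \<le> ereal h * (\<Sum>k. \<phi> (v (Suc k)))"
    using h by (simp add: sum_v sum_\<phi> mult.assoc)
  have part2: "ereal h * (\<Sum>k. \<phi> (v (Suc k))) \<le> E0"
    using sum_a(2) suminf_mult[OF sa, of h] by (simp add: E0 sum_\<phi>)

  have "(\<lambda>k. v (Suc k)) \<longlonglongrightarrow> 0"
    using summable_LIMSEQ_zero[OF sv] by (rule tendsto_norm_zero_cancel)
  then have v_lim: "v \<longlonglongrightarrow> 0" and vS_lim: "(\<lambda>k. v (Suc k)) \<longlonglongrightarrow> 0"
    by (simp_all add: filterlim_sequentially_Suc)
  have dv_lim: "(\<lambda>k. v (Suc k) - v k) \<longlonglongrightarrow> 0"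
    using tendsto_diff[OF vS_lim v_lim] by simp
  \<comment> \<open>The position update uses the new velocity, so the sum starts at
    \<open>v 1\<close>; its absolute convergence identifies the limit \<open>xi\<close>.\<close>
  have x_sum: "x n = x 0 + h *\<^sub>R (\<Sum>k<n. v (Suc k))" for n
    by (induction n) (simp_all add: x_step scaleR_add_right)
  define xi where "xi = x 0 + h *\<^sub>R (\<Sum>k. v (Suc k))"
  have "summable (\<lambda>k. v (Suc k))"
    using sv by (rule summable_norm_cancel_complete)
  then have x_lim: "x \<longlonglongrightarrow> xi"
    unfolding xi_def by (subst ext[of x, OF x_sum]) (intro tendsto_intros summable_LIMSEQ)
  have y_lim: "y \<longlonglongrightarrow> xi"
  proof -
    have "(\<lambda>k. x k + \<beta> *\<^sub>R v k) \<longlonglongrightarrow> xi + \<beta> *\<^sub>R 0"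
      by (intro tendsto_intros x_lim v_lim)
    then show ?thesis by (simp flip: assms(19))
  qed
  have "(\<lambda>k. gradf (y k)) \<longlonglongrightarrow> gradf xi"
    using continuous_on_tendsto_compose[OF assms(5) y_lim] by simp
  \<comment> \<open>The recursion is solved for the selected subgradient: since \<open>h\<close> is
    fixed, every other term converges, and so does \<open>p\<close>.\<close>
  then have "(\<lambda>k. - ((v (Suc k) - v k) /\<^sub>R h) - \<gamma> *\<^sub>R v (Suc k) - gradf (y k))
      \<longlonglongrightarrow> - (0 /\<^sub>R h) - \<gamma> *\<^sub>R 0 - gradf xi"
    by (intro tendsto_intros dv_lim vS_lim)
  moreover have "- ((v (Suc k) - v k) /\<^sub>R h) - \<gamma> *\<^sub>R v (Suc k) - gradf (y k) = p k" for k
    using step[of k] by (simp add: algebra_simps eq_neg_iff_add_eq_0)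
  ultimately have p_lim: "p \<longlonglongrightarrow> - gradf xi"
    by simp
  have "ereal (- gradf xi \<bullet> z) \<le> \<phi> z" for z
  proof (cases "\<phi> z")
    case (real c)
    have "p k \<bullet> (z - v (Suc k)) \<le> c" for k
      using p_le[of k z] a_nonneg[of "Suc k"] by (simp add: a real)
    moreover have "(\<lambda>k. p k \<bullet> (z - v (Suc k))) \<longlonglongrightarrow> - gradf xi \<bullet> (z - 0)"
      by (intro tendsto_intros p_lim vS_lim)
    ultimately have "- gradf xi \<bullet> (z - 0) \<le> c"
      by (intro LIMSEQ_le_const2) auto
    then show ?thesis by (simp add: real)
  qed (use \<phi>_ge_0[of z] in auto)
  then have opt: "- gradf xi \<in> subdifferential \<phi> 0"
    by (simp add: subdifferential_def assms(12))

  have part4: "summable (\<lambda>k. (norm (v (Suc k)))\<^sup>2 + (norm (d (Suc k)))\<^sup>2)"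
    if pd: "pos_def (M_mat h \<gamma> \<beta> L)"
  proof -
    obtain c where "c > 0" and c: "\<And>z. c * (norm z)\<^sup>2 \<le> z \<bullet> (M_mat h \<gamma> \<beta> L *v z)"
      using pos_def_coercive[OF pd] by blast
    have "c * ((norm (v (Suc k)))\<^sup>2 + (norm (d (Suc k)))\<^sup>2) \<le> q k" for k
      unfolding q_def using pd c by (intro quadratic_form_inner_space_ge) (auto simp: pos_def_def)
    \<comment> \<open>Here the nonnegative term \<open>h * a (Suc k)\<close> is discarded and the
      coercive lower bound of \<open>q k\<close> is telescoped.\<close>
    then have "E (Suc k) + c * ((norm (v (Suc k)))\<^sup>2 + (norm (d (Suc k)))\<^sup>2) \<le> E k" for k
      using decrease[of k] ha_nonneg[of k] by (smt (verit))
    then have "summable (\<lambda>k. c * ((norm (v (Suc k)))\<^sup>2 + (norm (d (Suc k)))\<^sup>2))"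
      by (rule summable_telescoping_bound(1)[OF _ E_nonneg]) (use \<open>c > 0\<close> in simp)
    then show ?thesis
      using \<open>c > 0\<close> by (simp add: summable_cmult_iff)
  qed
  have "(\<lambda>k. d (Suc k)) \<longlonglongrightarrow> 0"
    using dv_lim by (simp add: assms(20))
  with part1 part2 part4 x_lim v_lim y_lim opt show ?thesis
    by blast
qed

end
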